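(* Let $H$ be a hexagonal ring with $n$ hexagons and type $M_1M_2\cdots M_n$, where each $M_i\in\{t(1),t(2),t(3)\}$. Then the number of maximal matchings of $H$ is $$\Psi(H)=\operatorname{tr}\Big(\prod_{i=1}^{n} f(M_i)\Big)=\operatorname{tr}\big(f(M_1)f(M_2)\cdots f(M_n)\big),$$ where $f(t(1))=L$, $f(t(2))=S$, $f(t(3))=R$, and $\operatorname{tr}$ denotes the trace of a matrix.
   Context: A matching of a graph is maximal if it is not contained in any larger matching; $\Psi(X)$ denotes the number of maximal matchings of a graph $X$. A hexagonal ring with $n$ hexagons is a 2-connected plane graph obtained as follows. There are $n$ hexagons (6-cycles) $H_1,\dots,H_n$ (the faces), arranged cyclically: for $i=2,\dots,n$ the hexagons $H_{i-1}$ and $H_i$ share exactly one edge $e_i$, the hexagons $H_n$ and $H_1$ share exactly one edge $e_1$, no other pair of hexagons shares an edge, and every vertex lies on at most two hexagons. Fix a planar embedding, so that each hexagon has a clockwise direction. For each $i$ (indices mod $n$, $e_{n+1}=e_1$), let $k_i\in\{1,2,3\}$ be the number of edges of $H_i$ lying strictly between $e_i$ and $e_{i+1}$ when $H_i$ is traversed clockwise starting from $e_i$. The type of $H$ is $M_1M_2\cdots M_n$ with $M_i=t(k_i)$ (so $t(2)$ is linear, $t(1)$ left angular, $t(3)$ right angular attachment). The matrices are $$S=\begin{pmatrix} 1&1&1&1&1&1&1&0&0\\ 0&1&0&1&0&0&1&1&0\\ 0&0&1&1&0&1&0&0&1\\ 0&0&0&1&1&1&1&0&0\\ 1&0&0&1&1&1&1&0&0\\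 0&1&0&0&0&0&0&1&0\\ 0&0&1&0&0&0&0&0&1\\ 1&0&1&1&1&1&1&0&0\\ 1&1&0&1&1&1&1&0&0 \end{pmatrix},\quad L=\begin{pmatrix} 1&1&1&1&1&1&1&0&0\\ 1&0&1&0&0&0&0&0&1\\ 0&1&0&1&0&0&1&1&0\\ 1&0&1&0&0&0&0&0&0\\ 1&0&1&1&0&1&0&0&0\\ 0&0&1&0&0&0&0&0&1\\ 0&1&0&1&0&0&0&0&0\\ 1&1&1&1&0&1&0&0&0\\ 1&0&1&1&1&1&1&0&0 \end{pmatrix},\quad R=\begin{pmatrix} 1&1&1&1&1&1&1&0&0\\ 0&0&1&1&0&1&0&0&1\\ 1&1&0&0&0&0&0&1&0\\ 1&1&0&0&0&0&0&0&0\\ 1&1&0&1&0&0&1&0&0\\ 0&0&1&1&0&0&0&0&0\\ 0&1&0&0&0&0&0&1&0\\ 1&1&0&1&1&1&1&0&0\\ 1&1&1&1&0&0&1&0&0 \end{pmatrix}.$$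
   Formalization: Hexagons are also required to meet only in the shared edges e_i and their ends; if two hexagons may touch in a further vertex the formula fails (n=4, all linear, inner midpoints of two opposite hexagons identified: 211 maximal matchings, not tr(S^4)=265). *)

theory Defs
  imports
    "Graph_Theory.Digraph_Component"
    "HOL-Combinatorics.Orbits"
    "Jordan_Normal_Form.Matrix"
begin

section \<open>Maximal matchings\<close>

text \<open>A finite simple graph is a \<open>pair_graph\<close>, whose arcs are the two orientations (darts) of
  each undirected edge; an edge is the two-element set of its ends.\<close>

definition dart_edge :: "'a \<times> 'a \<Rightarrow> 'a set" where
  "dart_edge d = {fst d, snd d}"

definition graph_edges :: "'a pair_pre_digraph \<Rightarrow> 'a set set" where
  "graph_edges G = dart_edge ` parcs G"

definition is_matching :: "'a pair_pre_digraph \<Rightarrow> 'a set set \<Rightarrow> bool" where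
  "is_matching G M \<longleftrightarrow> M \<subseteq> graph_edges G \<and> (\<forall>a\<in>M. \<forall>b\<in>M. a \<noteq> b \<longrightarrow> a \<inter> b = {})"

definition is_maximal_matching :: "'a pair_pre_digraph \<Rightarrow> 'a set set \<Rightarrow> bool" where
  "is_maximal_matching G M \<longleftrightarrow> is_matching G M \<and> \<not> (\<exists>M'. is_matching G M' \<and> M \<subset> M')"

definition num_maximal_matchings :: "'a pair_pre_digraph \<Rightarrow> nat" where
  "num_maximal_matchings G = card {M. is_maximal_matching G M}"

section \<open>Plane graphs\<close>

text \<open>An embedding is given by its rotation system: \<open>rot\<close> sends a dart to the next dart,
  counterclockwise, around the same tail. Arriving at \<open>v\<close> along \<open>(u, v)\<close> and leaving along
  \<open>rot (v, u)\<close> then keeps the face on the right-hand side, so each orbit of \<open>face_step rot\<close> is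
  the boundary of one face, and bounded faces are traversed clockwise.\<close>

definition face_step :: "('a \<times> 'a \<Rightarrow> 'a \<times> 'a) \<Rightarrow> 'a \<times> 'a \<Rightarrow> 'a \<times> 'a" where
  "face_step rot = rot \<circ> prod.swap"

definition faces :: "'a pair_pre_digraph \<Rightarrow> ('a \<times> 'a \<Rightarrow> 'a \<times> 'a) \<Rightarrow> ('a \<times> 'a) set set" where
  "faces G rot = orbit (face_step rot) ` parcs G"

definition face_verts :: "('a \<times> 'a) set \<Rightarrow> 'a set" where
  "face_verts F = fst ` F"

definition face_edges :: "('a \<times> 'a) set \<Rightarrow> 'a set set" where
  "face_edges F = dart_edge ` F"

text \<open>The last conjunct is Euler's formula, saying that the rotation system has genus 0. It is the
  right formula for connected graphs with at least one edge (an edgeless graph has no dart and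
  hence no orbit).\<close>

definition plane_graph :: "'a pair_pre_digraph \<Rightarrow> ('a \<times> 'a \<Rightarrow> 'a \<times> 'a) \<Rightarrow> bool" where
  "plane_graph G rot \<longleftrightarrow>
     pair_graph G \<and> connected (with_proj G) \<and>
     rot permutes parcs G \<and>
     (\<forall>v\<in>pverts G. out_arcs (with_proj G) v \<noteq> {} \<longrightarrow> cyclic_on rot (out_arcs (with_proj G) v)) \<and>
     card (pverts G) + card (faces G rot) = card (graph_edges G) + 2"

definition two_connected :: "'a pair_pre_digraph \<Rightarrow> bool" where
  "two_connected G \<longleftrightarrow>
     3 \<le> card (pverts G) \<and> connected (with_proj G) \<and>
     (\<forall>v\<in>pverts G. connected (pre_digraph.del_vert (with_proj G) v))"

section \<open>Hexagonal rings\<close>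

text \<open>A face whose boundary is a 6-cycle.\<close>

definition is_hexagon ::
  "'a pair_pre_digraph \<Rightarrow> ('a \<times> 'a \<Rightarrow> 'a \<times> 'a) \<Rightarrow> ('a \<times> 'a) set \<Rightarrow> bool" where
  "is_hexagon G rot F \<longleftrightarrow> F \<in> faces G rot \<and> card F = 6 \<and> card (face_verts F) = 6"

text \<open>The hexagons are \<open>H 0, \<dots>, H (n - 1)\<close>, and \<open>e i\<close> is the edge that \<open>H i\<close> shares with its
  cyclic predecessor. Hexagons meet only along shared edges: consecutive ones have no common vertex
  besides the ends of the shared edge, others are disjoint. (Two hexagons touching in a single
  vertex would pinch the ring.) The bound \<open>3 \<le> n\<close> is what makes \<open>e i\<close> and \<open>e (i + 1)\<close> two
  different edges while any two hexagons share at most one.\<close>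

definition hexagonal_ring ::
  "'a pair_pre_digraph \<Rightarrow> ('a \<times> 'a \<Rightarrow> 'a \<times> 'a) \<Rightarrow> nat \<Rightarrow> (nat \<Rightarrow> ('a \<times> 'a) set) \<Rightarrow>
    (nat \<Rightarrow> 'a set) \<Rightarrow> bool" where
  "hexagonal_ring G rot n H e \<longleftrightarrow>
     plane_graph G rot \<and> two_connected G \<and> 3 \<le> n \<and>
     (\<forall>i<n. is_hexagon G rot (H i)) \<and>
     pverts G = (\<Union>i<n. face_verts (H i)) \<and>
     graph_edges G = (\<Union>i<n. face_edges (H i)) \<and>
     (\<forall>i<n. face_edges (H i) \<inter> face_edges (H (Suc i mod n)) = {e (Suc i mod n)} \<and>
            face_verts (H i) \<inter> face_verts (H (Suc i mod n)) = e (Suc i mod n)) \<and>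
     (\<forall>i<n. \<forall>j<n. i \<noteq> j \<and> j \<noteq> Suc i mod n \<and> i \<noteq> Suc j mod n \<longrightarrow>
            face_edges (H i) \<inter> face_edges (H j) = {} \<and>
            face_verts (H i) \<inter> face_verts (H j) = {}) \<and>
     (\<forall>v\<in>pverts G. card {i. i < n \<and> v \<in> face_verts (H i)} \<le> 2)"

text \<open>The number of steps from the dart following \<open>a\<close> to the dart on \<open>b\<close> is the number of edges
  strictly between \<open>a\<close> and \<open>b\<close> on the clockwise boundary of \<open>F\<close>.\<close>

definition edges_between ::
  "('a \<times> 'a \<Rightarrow> 'a \<times> 'a) \<Rightarrow> ('a \<times> 'a) set \<Rightarrow> 'a set \<Rightarrow> 'a set \<Rightarrow> nat" where
  "edges_between rot F a b =
     funpow_dist (face_step rot)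
       (face_step rot (THE d. d \<in> F \<and> dart_edge d = a)) (THE d. d \<in> F \<and> dart_edge d = b)"

datatype attachment = Left_Angular | Linear | Right_Angular

text \<open>\<open>M = t(k)\<close> is expressed as \<open>attachment_size M = k\<close>.\<close>

fun attachment_size :: "attachment \<Rightarrow> nat" where
  "attachment_size Left_Angular = 1"
| "attachment_size Linear = 2"
| "attachment_size Right_Angular = 3"

definition has_ring_type ::
  "('a \<times> 'a \<Rightarrow> 'a \<times> 'a) \<Rightarrow> nat \<Rightarrow> (nat \<Rightarrow> ('a \<times> 'a) set) \<Rightarrow> (nat \<Rightarrow> 'a set) \<Rightarrow>
    attachment list \<Rightarrow> bool" where
  "has_ring_type rot n H e Ms \<longleftrightarrow>
     length Ms = n \<and>
     (\<forall>i<n. edges_between rot (H i) (e i) (e (Suc i mod n)) = attachment_size (Ms ! i))"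

section \<open>Transfer matrices\<close>

definition mat_S :: "int mat" where
  "mat_S = mat_of_rows_list 9
    [[1,1,1,1,1,1,1,0,0],
     [0,1,0,1,0,0,1,1,0],
     [0,0,1,1,0,1,0,0,1],
     [0,0,0,1,1,1,1,0,0],
     [1,0,0,1,1,1,1,0,0],
     [0,1,0,0,0,0,0,1,0],
     [0,0,1,0,0,0,0,0,1],
     [1,0,1,1,1,1,1,0,0],
     [1,1,0,1,1,1,1,0,0]]"

definition mat_L :: "int mat" where
  "mat_L = mat_of_rows_list 9
    [[1,1,1,1,1,1,1,0,0],
     [1,0,1,0,0,0,0,0,1],
     [0,1,0,1,0,0,1,1,0],
     [1,0,1,0,0,0,0,0,0],
     [1,0,1,1,0,1,0,0,0],
     [0,0,1,0,0,0,0,0,1],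
     [0,1,0,1,0,0,0,0,0],
     [1,1,1,1,0,1,0,0,0],
     [1,0,1,1,1,1,1,0,0]]"

definition mat_R :: "int mat" where
  "mat_R = mat_of_rows_list 9
    [[1,1,1,1,1,1,1,0,0],
     [0,0,1,1,0,1,0,0,1],
     [1,1,0,0,0,0,0,1,0],
     [1,1,0,0,0,0,0,0,0],
     [1,1,0,1,0,0,1,0,0],
     [0,0,1,1,0,0,0,0,0],
     [0,1,0,0,0,0,0,1,0],
     [1,1,0,1,1,1,1,0,0],
     [1,1,1,1,0,0,1,0,0]]"

fun attachment_mat :: "attachment \<Rightarrow> int mat" where
  "attachment_mat Left_Angular = mat_L"
| "attachment_mat Linear = mat_S"
| "attachment_mat Right_Angular = mat_R"

definition mat_trace :: "'a::comm_monoid_add mat \<Rightarrow> 'a" where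
  "mat_trace A = (\<Sum>i<dim_row A. A $$ (i, i))"

end

theory Submission
  imports Defs "Jordan_Normal_Form.Matrix_IArray_Impl"
begin

text \<open>
  The shared edges of consecutive hexagons are the rungs of a cyclic ladder whose two sides are the
  boundary cycles of the ring. A matching meets a rung in one of 9 ways: the rung is used, or each
  end is matched backwards, matched forwards or unmatched, but not both unmatched. On a path of at
  most three edges between two rungs the states of the rungs determine a maximal matching. So
  maximal matchings correspond to closed walks of states, and \<open>\<Psi>\<close> is the trace of a product of 0/1
  transfer matrices \<open>A(M\<^sub>i)\<close>.

  These are not the matrices of the theorem, nor simultaneously conjugate to them, but there are
  \<open>U\<close> and \<open>V(M)\<close> with \<open>f(M) = U V(M)\<close> and \<open>A(M) = V(M) U\<close>, so the two products have the same trace.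
\<close>

section \<open>Traces of matrix products\<close>

lemma mat_trace_mult_commute:
  fixes A B :: "'a::comm_semiring_0 mat"
  assumes "A \<in> carrier_mat m n" "B \<in> carrier_mat n m"
  shows "mat_trace (A * B) = mat_trace (B * A)"
proof -
  have "mat_trace (A * B) = (\<Sum>i<m. \<Sum>j<n. A $$ (i, j) * B $$ (j, i))"
    using assms by (auto simp: mat_trace_def scalar_prod_def atLeast0LessThan intro!: sum.cong)
  also have "\<dots> = (\<Sum>j<n. \<Sum>i<m. B $$ (j, i) * A $$ (i, j))"
    by (subst sum.swap) (simp add: mult.commute)
  also have "\<dots> = mat_trace (B * A)"
    using assms by (auto simp: mat_trace_def scalar_prod_def atLeast0LessThan intro!: sum.cong)
  finally show ?thesis .
qed

lemma foldr_mult_carrier_mat: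
  assumes "\<And>A. A \<in> set As \<Longrightarrow> A \<in> carrier_mat n n"
  shows "foldr (*) As (1\<^sub>m n) \<in> carrier_mat n n"
  using assms by (induction As) (auto intro!: mult_carrier_mat)

lemma foldr_mult_intertwine:
  fixes U :: "'a::semiring_1 mat"
  assumes U: "U \<in> carrier_mat m n" and V: "\<And>x. V x \<in> carrier_mat n m"
  shows "foldr (*) (map (\<lambda>x. U * V x) xs) (1\<^sub>m m) * U = U * foldr (*) (map (\<lambda>x. V x * U) xs) (1\<^sub>m n)"
proof (induction xs)
  case Nil
  then show ?case using U by simp
next
  case (Cons x xs)
  let ?P = "foldr (*) (map (\<lambda>x. U * V x) xs) (1\<^sub>m m)"
  let ?Q = "foldr (*) (map (\<lambda>x. V x * U) xs) (1\<^sub>m n)"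
  have P: "?P \<in> carrier_mat m m" and Q: "?Q \<in> carrier_mat n n"
    using U V by (auto intro!: foldr_mult_carrier_mat mult_carrier_mat)
  have "U * V x * ?P * U = U * V x * (?P * U)"
    using U V P by (intro assoc_mult_mat[of _ m m _ m _ n]) auto
  also have "\<dots> = U * V x * (U * ?Q)"
    by (simp only: Cons.IH)
  also have "\<dots> = U * (V x * (U * ?Q))"
    using U V Q by (intro assoc_mult_mat[of _ m n _ m _ n]) auto
  also have "V x * (U * ?Q) = V x * U * ?Q"
    using U V Q by (intro assoc_mult_mat[of _ n m _ n _ n, symmetric]) auto
  finally show ?case by simp
qed

lemma mat_trace_foldr_mult_swap:
  fixes U :: "'a::comm_semiring_1 mat"
  assumes U: "U \<in> carrier_mat m n" and V: "\<And>x. V x \<in> carrier_mat n m" and "xs \<noteq> []"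
  shows "mat_trace (foldr (*) (map (\<lambda>x. U * V x) xs) (1\<^sub>m m)) =
    mat_trace (foldr (*) (map (\<lambda>x. V x * U) xs) (1\<^sub>m n))"
proof -
  obtain y ys where xs: "xs = y # ys"
    using \<open>xs \<noteq> []\<close> by (cases xs) auto
  let ?P = "foldr (*) (map (\<lambda>x. U * V x) ys) (1\<^sub>m m)"
  let ?Q = "foldr (*) (map (\<lambda>x. V x * U) ys) (1\<^sub>m n)"
  have P: "?P \<in> carrier_mat m m" and Q: "?Q \<in> carrier_mat n n"
    using U V by (auto intro!: foldr_mult_carrier_mat mult_carrier_mat)
  have "mat_trace (U * V y * ?P) = mat_trace (U * (V y * ?P))"
    using U V P by (subst assoc_mult_mat[of _ m n _ m _ m]) auto
  also have "\<dots> = mat_trace (V y * ?P * U)"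
    using U V P by (intro mat_trace_mult_commute[of _ m n]) (auto intro!: mult_carrier_mat)
  also have "V y * ?P * U = V y * (?P * U)"
    using U V P by (intro assoc_mult_mat[of _ n m _ m _ n]) auto
  also have "\<dots> = V y * (U * ?Q)"
    by (simp only: foldr_mult_intertwine[OF U V])
  also have "\<dots> = V y * U * ?Q"
    using U V Q by (intro assoc_mult_mat[of _ n m _ n _ n, symmetric]) auto
  finally show ?thesis by (simp add: xs)
qed

section \<open>Closed walks and transfer matrices\<close>

definition transfer_mat :: "'s list \<Rightarrow> ('s \<Rightarrow> 's \<Rightarrow> bool) \<Rightarrow> 'a::zero_neq_one mat" where
  "transfer_mat ss R = mat (length ss) (length ss) (\<lambda>(i, j). of_bool (R (ss ! i) (ss ! j)))"

definition walks :: "'s set \<Rightarrow> ('k \<Rightarrow> 's \<Rightarrow> 's \<Rightarrow> bool) \<Rightarrow> 'k list \<Rightarrow> 's \<Rightarrow> 's \<Rightarrow> 's list set" where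
  "walks S R ks a b = {xs. length xs = length ks \<and> set xs \<subseteq> S \<and> (xs @ [b]) ! 0 = a \<and>
     (\<forall>i<length ks. R (ks ! i) (xs ! i) ((xs @ [b]) ! Suc i))}"

definition closed_walks :: "'s set \<Rightarrow> ('k \<Rightarrow> 's \<Rightarrow> 's \<Rightarrow> bool) \<Rightarrow> 'k list \<Rightarrow> 's list set" where
  "closed_walks S R ks = {xs. length xs = length ks \<and> set xs \<subseteq> S \<and>
     (\<forall>i<length ks. R (ks ! i) (xs ! i) (xs ! (Suc i mod length ks)))}"

lemma finite_walks: "finite S \<Longrightarrow> finite (walks S R ks a b)"
  by (rule finite_subset[OF _ finite_lists_length_eq[of S "length ks"]]) (auto simp: walks_def)

lemma walks_Nil: "walks S R [] a b = (if a = b then {[]} else {})"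
  by (auto simp: walks_def)

lemma walks_Cons:
  assumes "a \<in> S" "b \<in> S"
  shows "walks S R (k # ks) a b = (#) a ` (\<Union>x\<in>{x \<in> S. R k a x}. walks S R ks x b)"
proof (intro Set.set_eqI)
  fix ys
  have "(xs @ [b]) ! 0 \<in> S" if "set xs \<subseteq> S" for xs
    using that \<open>b \<in> S\<close> by (cases xs) auto
  then show "ys \<in> walks S R (k # ks) a b \<longleftrightarrow>
      ys \<in> (#) a ` (\<Union>x\<in>{x \<in> S. R k a x}. walks S R ks x b)"
    using \<open>a \<in> S\<close> by (cases ys) (auto simp: walks_def All_less_Suc2)
qed

lemma card_walks_Cons:
  assumes "finite S" "a \<in> S" "b \<in> S"
  shows "card (walks S R (k # ks) a b) = (\<Sum>x\<in>S. of_bool (R k a x) * card (walks S R ks x b))"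
proof -
  have "card (walks S R (k # ks) a b) = card (\<Union>x\<in>{x \<in> S. R k a x}. walks S R ks x b)"
    unfolding walks_Cons[OF assms(2,3)] by (rule card_image) simp
  also have "\<dots> = (\<Sum>x\<in>{x \<in> S. R k a x}. card (walks S R ks x b))"
    using assms by (intro card_UN_disjoint) (auto simp: finite_walks, auto simp: walks_def)
  also have "\<dots> = (\<Sum>x\<in>S. of_bool (R k a x) * card (walks S R ks x b))"
    using assms by (intro sum.mono_neutral_cong_left) auto
  finally show ?thesis .
qed

lemma index_foldr_mult_transfer_mat:
  assumes "distinct ss" "i < length ss" "j < length ss"
  shows "foldr (*) (map (\<lambda>k. transfer_mat ss (R k)) ks) (1\<^sub>m (length ss)) $$ (i, j) =
    (of_nat (card (walks (set ss) R ks (ss ! i) (ss ! j))) :: 'a::comm_semiring_1)"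
  using assms(2)
proof (induction ks arbitrary: i)
  case Nil
  then show ?case using assms by (simp add: walks_Nil nth_eq_iff_index_eq)
next
  case (Cons k ks)
  let ?P = "foldr (*) (map (\<lambda>k. transfer_mat ss (R k)) ks) (1\<^sub>m (length ss)) :: 'a mat"
  let ?w = "\<lambda>x. of_bool (R k (ss ! i) x) * of_nat (card (walks (set ss) R ks x (ss ! j))) :: 'a"
  have "?P \<in> carrier_mat (length ss) (length ss)"
    by (rule foldr_mult_carrier_mat) (auto simp: transfer_mat_def)
  then have "(transfer_mat ss (R k) * ?P) $$ (i, j) =
      (\<Sum>l<length ss. of_bool (R k (ss ! i) (ss ! l)) * ?P $$ (l, j))"
    using Cons.prems assms(3)
    by (auto simp: transfer_mat_def scalar_prod_def atLeast0LessThan intro!: sum.cong)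
  also have "\<dots> = (\<Sum>l<length ss. ?w (ss ! l))"
    using Cons.IH by simp
  also have "\<dots> = (\<Sum>x\<in>set ss. ?w x)"
    by (rule sum.reindex_bij_betw[OF bij_betw_nth[OF assms(1)]]) auto
  also have "\<dots> = of_nat (card (walks (set ss) R (k # ks) (ss ! i) (ss ! j)))"
    using Cons.prems assms(3) by (simp add: card_walks_Cons)
  finally show ?case by simp
qed

lemma walks_same_ends:
  assumes "ks \<noteq> []"
  shows "walks S R ks a a = {xs \<in> closed_walks S R ks. xs ! 0 = a}"
proof (intro Set.set_eqI)
  fix xs
  show "xs \<in> walks S R ks a a \<longleftrightarrow> xs \<in> {xs \<in> closed_walks S R ks. xs ! 0 = a}"
  proof (cases "length xs = length ks \<and> xs ! 0 = a")
    case True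
    then have "(xs @ [a]) ! Suc i = xs ! (Suc i mod length ks)" if "i < length ks" for i
      using that by (cases "Suc i = length ks") (auto simp: nth_append)
    then show ?thesis
      using True assms by (simp add: walks_def closed_walks_def nth_append)
  next
    case False
    then show ?thesis
      using assms by (auto simp: walks_def closed_walks_def nth_append)
  qed
qed

lemma mat_trace_foldr_mult_transfer_mat:
  assumes "distinct ss" "ks \<noteq> []"
  shows "mat_trace (foldr (*) (map (\<lambda>k. transfer_mat ss (R k)) ks) (1\<^sub>m (length ss))) =
    (of_nat (card (closed_walks (set ss) R ks)) :: 'a::comm_semiring_1)" (is "mat_trace ?P = _")
proof -
  have "?P \<in> carrier_mat (length ss) (length ss)"
    by (rule foldr_mult_carrier_mat) (auto simp: transfer_mat_def)
  then have "mat_trace ?P = (\<Sum>i<length ss. ?P $$ (i, i))"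
    by (simp add: mat_trace_def)
  also have "\<dots> = (\<Sum>i<length ss. of_nat (card (walks (set ss) R ks (ss ! i) (ss ! i))))"
    using assms(1) by (simp add: index_foldr_mult_transfer_mat)
  also have "\<dots> = (\<Sum>x\<in>set ss. of_nat (card (walks (set ss) R ks x x)))"
    by (rule sum.reindex_bij_betw[OF bij_betw_nth[OF assms(1)]]) auto
  also have "\<dots> = of_nat (card (\<Union>x\<in>set ss. walks (set ss) R ks x x))"
    by (subst card_UN_disjoint) (auto simp: finite_walks, auto simp: walks_same_ends[OF assms(2)])
  also have "(\<Union>x\<in>set ss. walks (set ss) R ks x x) = closed_walks (set ss) R ks"
  proof -
    have "xs ! 0 \<in> set ss" if "xs \<in> closed_walks (set ss) R ks" for xs
      using that assms(2) by (cases xs) (auto simp: closed_walks_def)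
    then show ?thesis by (auto simp: walks_same_ends[OF assms(2)])
  qed
  finally show ?thesis .
qed

section \<open>States of a rung\<close>

text \<open>The rungs, i.e. the shared edges of the hexagons, cut every hexagon of type \<open>t(k)\<close> into a path
  of \<open>k\<close> edges on the left and one of \<open>4 - k\<close> edges on the right, seen in the direction of
  increasing indices.\<close>

datatype side = Left | Right

fun side_length :: "attachment \<Rightarrow> side \<Rightarrow> nat" where
  "side_length m Left = attachment_size m"
| "side_length m Right = 4 - attachment_size m"

text \<open>\<open>Backward\<close> and \<open>Forward\<close> mean matched by an edge of the previous or of the next hexagon other
  than the rung.\<close>

datatype end_state = Crossing | Backward | Forward | Unmatched

type_synonym rung_state = "side \<Rightarrow> end_state"

definition valid_state :: "rung_state \<Rightarrow> bool" where
  "valid_state s \<longleftrightarrow> (s Left = Crossing \<longleftrightarrow> s Right = Crossing) \<and> (\<exists>\<sigma>. s \<sigma> \<noteq> Unmatched)"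

definition rung_states :: "rung_state list" where
  "rung_states = [
     case_side Crossing Crossing,
     case_side Backward Backward, case_side Backward Forward, case_side Backward Unmatched,
     case_side Forward Backward, case_side Forward Forward, case_side Forward Unmatched,
     case_side Unmatched Backward, case_side Unmatched Forward]"

lemma rung_state_eq_iff: "(s :: rung_state) = t \<longleftrightarrow> s Left = t Left \<and> s Right = t Right"
  by (metis ext side.exhaust)

lemma all_side_iff: "(\<forall>\<sigma>. P \<sigma>) \<longleftrightarrow> P Left \<and> P Right"
  by (metis side.exhaust)

lemma ex_side_iff: "(\<exists>\<sigma>. P \<sigma>) \<longleftrightarrow> P Left \<or> P Right"
  by (metis side.exhaust)

lemma length_rung_states: "length rung_states = 9"
  by (simp add: rung_states_def)

lemma distinct_rung_states: "distinct rung_states"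
  by (simp add: rung_states_def rung_state_eq_iff)

lemma set_rung_states: "set rung_states = Collect valid_state"
proof -
  have "s \<in> set rung_states \<longleftrightarrow> valid_state s" for s
    by (cases "s Left"; cases "s Right")
      (simp_all add: rung_states_def rung_state_eq_iff valid_state_def ex_side_iff)
  then show ?thesis by auto
qed

text \<open>A path of \<open>k\<close> edges has vertices \<open>0, \<dots>, k\<close>, and edge \<open>j\<close> joins \<open>j\<close> and \<open>j + 1\<close>;
  \<open>y j\<close> says whether edge \<open>j\<close> is in the matching, and \<open>a\<close> and \<open>b\<close> are the states of the two ends.
  The rungs at the ends are not part of the path.\<close>

definition path_covered :: "nat \<Rightarrow> (nat \<Rightarrow> bool) \<Rightarrow> end_state \<Rightarrow> end_state \<Rightarrow> nat \<Rightarrow> bool" where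
  "path_covered k y a b j \<longleftrightarrow>
     (if j = 0 then a \<noteq> Unmatched else if j = k then b \<noteq> Unmatched else y (j - 1) \<or> y j)"

definition path_matching :: "nat \<Rightarrow> (nat \<Rightarrow> bool) \<Rightarrow> end_state \<Rightarrow> end_state \<Rightarrow> bool" where
  "path_matching k y a b \<longleftrightarrow>
     (y 0 \<longleftrightarrow> a = Forward) \<and> (y (k - 1) \<longleftrightarrow> b = Backward) \<and>
     (\<forall>j\<in>{0<..<k}. \<not> (y (j - 1) \<and> y j)) \<and>
     (\<forall>j<k. path_covered k y a b j \<or> path_covered k y a b (Suc j))"

definition side_step :: "nat \<Rightarrow> end_state \<Rightarrow> end_state \<Rightarrow> bool" where
  "side_step k a b \<longleftrightarrow> (\<exists>y. path_matching k y a b)"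

lemma path_matching_cong:
  assumes "\<And>j. j < k \<Longrightarrow> y j = y' j" "0 < k"
  shows "path_matching k y a b \<longleftrightarrow> path_matching k y' a b"
proof -
  have "path_covered k y a b j \<longleftrightarrow> path_covered k y' a b j" if "j \<le> k" for j
    using that assms by (auto simp: path_covered_def)
  then show ?thesis
    unfolding path_matching_def using assms by (intro conj_cong ball_cong all_cong) auto
qed

lemma path_matching_length_1:
  "path_matching (Suc 0) y a b \<longleftrightarrow>
     (y 0 \<longleftrightarrow> a = Forward) \<and> (y 0 \<longleftrightarrow> b = Backward) \<and> \<not> (a = Unmatched \<and> b = Unmatched)"
  by (auto simp: path_matching_def path_covered_def)

lemma path_matching_length_2:
  "path_matching (Suc (Suc 0)) y a b \<longleftrightarrow>
     (y 0 \<longleftrightarrow> a = Forward) \<and> (y 1 \<longleftrightarrow> b = Backward) \<and> \<not> (a = Forward \<and> b = Backward) \<and>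
     (a = Unmatched \<longrightarrow> b = Backward) \<and> (b = Unmatched \<longrightarrow> a = Forward)"
proof -
  have "{0<..<Suc (Suc 0)} = {1}" by auto
  then show ?thesis by (auto simp: path_matching_def path_covered_def All_less_Suc)
qed

text \<open>An edge with two absent neighbours is present in a maximal matching.\<close>

lemma path_matching_length_3:
  "path_matching (Suc (Suc (Suc 0))) y a b \<longleftrightarrow>
     (y 0 \<longleftrightarrow> a = Forward) \<and> (y 1 \<longleftrightarrow> a \<noteq> Forward \<and> b \<noteq> Backward) \<and> (y 2 \<longleftrightarrow> b = Backward) \<and>
     \<not> (a = Unmatched \<and> b = Backward) \<and> \<not> (a = Forward \<and> b = Unmatched)"
proof -
  have "{0<..<Suc (Suc (Suc 0))} = {1, 2}" by auto
  then show ?thesis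
    by (auto simp: path_matching_def path_covered_def All_less_Suc numeral_2_eq_2)
qed

lemma path_matching_unique:
  assumes "path_matching k y a b" "path_matching k y' a b" "k \<le> 3" "j < k"
  shows "y j = y' j"
proof -
  consider "k = Suc 0" "j = 0" | "k = Suc (Suc 0)" "j = 0 \<or> j = 1"
    | "k = Suc (Suc (Suc 0))" "j = 0 \<or> j = 1 \<or> j = 2"
    using assms(3,4) by linarith
  then show ?thesis
    by cases (use assms(1,2) in \<open>auto simp: path_matching_length_1 path_matching_length_2
      path_matching_length_3\<close>)
qed

lemma side_step_length_1 [code]:
  "side_step (Suc 0) a b \<longleftrightarrow>
     (a = Forward \<longleftrightarrow> b = Backward) \<and> \<not> (a = Unmatched \<and> b = Unmatched)"
  unfolding side_step_def path_matching_length_1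
  by (auto intro!: exI[of _ "\<lambda>_. a = Forward"])

lemma side_step_length_2 [code]:
  "side_step (Suc (Suc 0)) a b \<longleftrightarrow>
     \<not> (a = Forward \<and> b = Backward) \<and>
     (a = Unmatched \<longrightarrow> b = Backward) \<and> (b = Unmatched \<longrightarrow> a = Forward)"
  unfolding side_step_def path_matching_length_2
  by (auto intro!: exI[of _ "(!) [a = Forward, b = Backward]"])

lemma side_step_length_3 [code]:
  "side_step (Suc (Suc (Suc 0))) a b \<longleftrightarrow>
     \<not> (a = Unmatched \<and> b = Backward) \<and> \<not> (a = Forward \<and> b = Unmatched)"
  unfolding side_step_def path_matching_length_3
  by (auto intro!: exI[of _ "(!) [a = Forward, a \<noteq> Forward \<and> b \<noteq> Backward, b = Backward]"])

definition hexagon_step :: "attachment \<Rightarrow> rung_state \<Rightarrow> rung_state \<Rightarrow> bool" where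
  "hexagon_step m s t \<longleftrightarrow> side_step (side_length m Left) (s Left) (t Left) \<and>
     side_step (side_length m Right) (s Right) (t Right)"

section \<open>Factorization of the transfer matrices\<close>

text \<open>\<open>mat_U\<close> spans the one-dimensional space of solutions \<open>U\<close> of \<open>f(M) U = U A(M)\<close> for all three
  types \<open>M\<close>, where \<open>A(M)\<close> is the transfer matrix of \<open>M\<close>; it has rank 8. Solving \<open>f(M) = U V(M)\<close> and
  \<open>A(M) = V(M) U\<close> gives \<open>mat_V M\<close>, whose rows are rows of \<open>f(M)\<close> or differences of two of them.\<close>

definition mat_U :: "int mat" where
  "mat_U = mat_of_rows_list 9
    [[1,0,0,0,0,1,1,0,1],
     [0,0,1,1,0,0,0,0,0],
     [0,0,0,0,1,0,0,1,0],
     [0,1,0,0,0,0,0,0,0],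
     [1,0,0,0,0,1,0,0,0],
     [0,0,1,0,0,0,0,0,0],
     [0,0,0,0,1,0,0,0,0],
     [1,0,0,0,0,1,1,0,0],
     [1,0,0,0,0,1,0,0,1]]"

fun mat_V :: "attachment \<Rightarrow> int mat" where
  "mat_V Left_Angular = mat_of_rows_list 9
    [[1,0,1,0,0,0,0,0,0],
     [1,0,1,0,0,0,0,0,0],
     [0,0,1,0,0,0,0,0,1],
     [1,0,0,0,0,0,0,0,0],
     [0,1,0,1,0,0,0,0,0],
     [0,0,0,1,0,1,0,0,0],
     [0,1,0,0,0,0,0,0,0],
     [0,0,0,0,0,0,1,1,0],
     [0,0,0,0,1,0,1,0,0]]"
| "mat_V Linear = mat_of_rows_list 9
    [[0,0,0,1,1,1,1,0,0],
     [0,0,0,1,1,1,1,0,0],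
     [0,1,0,0,0,0,0,1,0],
     [0,0,0,1,0,0,1,0,0],
     [0,0,1,0,0,0,0,0,1],
     [1,0,0,0,0,0,0,0,0],
     [0,0,1,0,0,0,0,0,0],
     [0,0,0,1,0,1,0,0,0],
     [0,1,0,0,0,0,0,0,0]]"
| "mat_V Right_Angular = mat_of_rows_list 9
    [[1,1,0,0,0,0,0,0,0],
     [1,1,0,0,0,0,0,0,0],
     [0,0,1,1,0,0,0,0,0],
     [0,0,0,0,0,1,0,0,1],
     [0,1,0,0,0,0,0,1,0],
     [0,0,0,1,0,0,1,0,0],
     [0,0,0,0,1,1,0,0,0],
     [1,0,0,0,0,0,0,0,0],
     [0,0,1,0,0,0,0,0,0]]"

lemma mat_U_carrier: "mat_U \<in> carrier_mat 9 9"
  by (rule carrier_matI) (simp_all add: mat_U_def mat_of_rows_list_def)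

lemma mat_V_carrier: "mat_V m \<in> carrier_mat 9 9"
  by (cases m; rule carrier_matI) (simp_all add: mat_of_rows_list_def)

lemma attachment_mat_eq_mult: "attachment_mat m = mat_U * mat_V m"
  by (induction m; code_simp)

lemma mat_V_mult_mat_U: "mat_V m * mat_U = transfer_mat rung_states (hexagon_step m)"
  by (induction m; code_simp)

lemma mat_trace_foldr_mult_attachment_mat:
  assumes "ms \<noteq> []"
  shows "mat_trace (foldr (*) (map attachment_mat ms) (1\<^sub>m 9)) =
    int (card (closed_walks (Collect valid_state) hexagon_step ms))"
proof -
  have "mat_trace (foldr (*) (map attachment_mat ms) (1\<^sub>m 9)) =
      mat_trace (foldr (*) (map (\<lambda>m. mat_U * mat_V m) ms) (1\<^sub>m 9))"
    by (simp add: attachment_mat_eq_mult[abs_def])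
  also have "\<dots> = mat_trace (foldr (*) (map (\<lambda>m. mat_V m * mat_U) ms) (1\<^sub>m 9))"
    using mat_U_carrier mat_V_carrier assms by (rule mat_trace_foldr_mult_swap)
  also have "\<dots> = int (card (closed_walks (set rung_states) hexagon_step ms))"
    unfolding mat_V_mult_mat_U
    using mat_trace_foldr_mult_transfer_mat[OF distinct_rung_states assms]
    by (simp add: length_rung_states)
  finally show ?thesis by (simp only: set_rung_states)
qed

section \<open>Maximal matchings of a cyclic ladder\<close>

lemma is_maximal_matching_iff:
  "is_maximal_matching G M \<longleftrightarrow> M \<subseteq> graph_edges G \<and> (\<forall>v. \<exists>\<^sub>\<le>\<^sub>1 a. a \<in> M \<and> v \<in> a) \<and>
     (\<forall>a\<in>graph_edges G. a \<inter> \<Union>M \<noteq> {})"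
proof -
  have matching: "is_matching G M \<longleftrightarrow> M \<subseteq> graph_edges G \<and> (\<forall>v. \<exists>\<^sub>\<le>\<^sub>1 a. a \<in> M \<and> v \<in> a)" for M
    by (auto simp: is_matching_def Uniq_def)
  have "(\<exists>M'. is_matching G M' \<and> M \<subset> M') \<longleftrightarrow> (\<exists>a\<in>graph_edges G. a \<inter> \<Union>M = {})"
    if "is_matching G M"
  proof
    assume "\<exists>M'. is_matching G M' \<and> M \<subset> M'"
    then obtain M' where M': "is_matching G M'" "M \<subset> M'" by blast
    then obtain a where a: "a \<in> M'" "a \<notin> M" by auto
    have "a \<inter> b = {}" if "b \<in> M" for b
    proof -
      have "b \<in> M'" "a \<noteq> b" using that M'(2) a by auto
      then show ?thesis using M'(1) a(1) by (simp add: is_matching_def)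
    qed
    moreover have "a \<in> graph_edges G"
      using M' a by (auto simp: is_matching_def)
    ultimately show "\<exists>a\<in>graph_edges G. a \<inter> \<Union>M = {}" by blast
  next
    assume "\<exists>a\<in>graph_edges G. a \<inter> \<Union>M = {}"
    then obtain a where a: "a \<in> graph_edges G" "a \<inter> \<Union>M = {}" by blast
    then have "a \<noteq> {}" by (auto simp: graph_edges_def dart_edge_def)
    then have "M \<subset> insert a M" using a by auto
    moreover have "is_matching G (insert a M)"
      using that a by (auto simp: is_matching_def)
    ultimately show "\<exists>M'. is_matching G M' \<and> M \<subset> M'" by blast
  qed
  then have "is_maximal_matching G M \<longleftrightarrow> is_matching G M \<and> (\<forall>a\<in>graph_edges G. a \<inter> \<Union>M \<noteq> {})"
    by (cases "is_matching G M") (simp_all add: is_maximal_matching_def)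
  then show ?thesis by (simp add: matching)
qed

lemma Suc_mod_surjE:
  assumes "i < n"
  obtains i' where "i' < n" "i = Suc i' mod n"
proof
  show "(if i = 0 then n - 1 else i - 1) < n" "i = Suc (if i = 0 then n - 1 else i - 1) mod n"
    using assms by auto
qed

locale cyclic_ladder =
  fixes G :: "'a pair_pre_digraph" and n :: nat and len :: "nat \<Rightarrow> side \<Rightarrow> nat"
    and vertex :: "nat \<Rightarrow> side \<Rightarrow> nat \<Rightarrow> 'a"
  assumes three_le: "3 \<le> n" and len_pos: "i < n \<Longrightarrow> 0 < len i \<sigma>"
    and vertex_len: "i < n \<Longrightarrow> vertex i \<sigma> (len i \<sigma>) = vertex (Suc i mod n) \<sigma> 0"
    and vertex_inject: "i < n \<Longrightarrow> j < len i \<sigma> \<Longrightarrow> i' < n \<Longrightarrow> j' < len i' \<sigma>' \<Longrightarrow>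
      vertex i \<sigma> j = vertex i' \<sigma>' j' \<Longrightarrow> i = i' \<and> \<sigma> = \<sigma>' \<and> j = j'"
    and graph_edges_eq: "graph_edges G = {{vertex i Left 0, vertex i Right 0} | i. i < n} \<union>
      {{vertex i \<sigma> j, vertex i \<sigma> (Suc j)} | i \<sigma> j. i < n \<and> j < len i \<sigma>}"
begin

definition succ :: "nat \<Rightarrow> nat" where
  "succ i = Suc i mod n"

definition rung :: "nat \<Rightarrow> 'a set" where
  "rung i = {vertex i Left 0, vertex i Right 0}"

definition side_edge :: "nat \<Rightarrow> side \<Rightarrow> nat \<Rightarrow> 'a set" where
  "side_edge i \<sigma> j = {vertex i \<sigma> j, vertex i \<sigma> (Suc j)}"

definition state :: "'a set set \<Rightarrow> nat \<Rightarrow> rung_state" where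
  "state M i \<sigma> =
     (if rung i \<in> M then Crossing else if side_edge i \<sigma> 0 \<in> M then Forward
      else if vertex i \<sigma> 0 \<in> \<Union>M then Backward else Unmatched)"

lemma succ_less: "succ i < n"
  using three_le by (simp add: succ_def)

lemma succ_neq: "i < n \<Longrightarrow> succ i \<noteq> i" "i < n \<Longrightarrow> succ (succ i) \<noteq> i"
  using three_le by (auto simp: succ_def mod_Suc)

lemma succ_inject: "i < n \<Longrightarrow> i' < n \<Longrightarrow> succ i = succ i' \<longleftrightarrow> i = i'"
  by (auto simp: succ_def mod_Suc split: if_splits)

lemma succ_surj:
  assumes "i < n"
  obtains i' where "i' < n" "i = succ i'"
  using Suc_mod_surjE[OF assms] unfolding succ_def by blast

lemma all_succ_iff: "(\<forall>i<n. P (succ i)) \<longleftrightarrow> (\<forall>i<n. P i)"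
  using succ_less succ_surj by metis

lemma rung_in_edges: "i < n \<Longrightarrow> rung i \<in> graph_edges G"
  by (auto simp: graph_edges_eq rung_def)

lemma side_edge_in_edges: "i < n \<Longrightarrow> j < len i \<sigma> \<Longrightarrow> side_edge i \<sigma> j \<in> graph_edges G"
  by (auto simp: graph_edges_eq side_edge_def)

lemma graph_edges_cases:
  assumes "a \<in> graph_edges G"
  obtains (rung) i where "i < n" "a = rung i"
  | (side_edge) i \<sigma> j where "i < n" "j < len i \<sigma>" "a = side_edge i \<sigma> j"
  using assms by (auto simp: graph_edges_eq rung_def side_edge_def)

lemma vertex_eq_iff:
  "i < n \<Longrightarrow> j < len i \<sigma> \<Longrightarrow> i' < n \<Longrightarrow> j' < len i' \<sigma>' \<Longrightarrow>
    vertex i \<sigma> j = vertex i' \<sigma>' j' \<longleftrightarrow> i = i' \<and> \<sigma> = \<sigma>' \<and> j = j'"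
  using vertex_inject by blast

lemma mem_rung_iff: "i < n \<Longrightarrow> j < len i \<sigma> \<Longrightarrow> i' < n \<Longrightarrow> vertex i \<sigma> j \<in> rung i' \<longleftrightarrow> i = i' \<and> j = 0"
  by (cases \<sigma>) (auto simp: rung_def vertex_eq_iff len_pos)

lemma mem_side_edge_iff:
  assumes "i < n" "j < len i \<sigma>" "i' < n" "j' < len i' \<sigma>'"
  shows "vertex i \<sigma> j \<in> side_edge i' \<sigma>' j' \<longleftrightarrow> \<sigma> = \<sigma>' \<and>
    (i = i' \<and> j = j' \<or> i = i' \<and> j = Suc j' \<or> i = succ i' \<and> j = 0 \<and> Suc j' = len i' \<sigma>')"
proof (cases "Suc j' = len i' \<sigma>'")
  case True
  then have "vertex i' \<sigma>' (Suc j') = vertex (succ i') \<sigma>' 0"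
    using vertex_len[of i' \<sigma>'] assms by (simp add: succ_def)
  then show ?thesis
    using assms True by (auto simp: side_edge_def vertex_eq_iff succ_less len_pos)
next
  case False
  then show ?thesis
    using assms by (auto simp: side_edge_def vertex_eq_iff)
qed

lemma rung_inject: "i < n \<Longrightarrow> i' < n \<Longrightarrow> rung i = rung i' \<longleftrightarrow> i = i'"
  using mem_rung_iff[of i 0 Left i'] len_pos by (auto simp: rung_def)

lemma rung_neq_side_edge:
  assumes "i < n" "i' < n" "j < len i' \<sigma>"
  shows "rung i \<noteq> side_edge i' \<sigma> j"
proof
  assume "rung i = side_edge i' \<sigma> j"
  then have "vertex i \<tau> 0 \<in> side_edge i' \<sigma> j" for \<tau>
    by (cases \<tau>) (auto simp: rung_def)
  then have "\<tau> = \<sigma>" for \<tau>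
    using assms by (simp add: mem_side_edge_iff len_pos)
  from this[of Left] this[of Right] show False by simp
qed

lemma side_edge_inject:
  assumes "i < n" "j < len i \<sigma>" "i' < n" "j' < len i' \<sigma>'"
  shows "side_edge i \<sigma> j = side_edge i' \<sigma>' j' \<longleftrightarrow> i = i' \<and> \<sigma> = \<sigma>' \<and> j = j'"
proof
  assume "side_edge i \<sigma> j = side_edge i' \<sigma>' j'"
  then have "vertex i \<sigma> j \<in> side_edge i' \<sigma>' j'" "vertex i' \<sigma>' j' \<in> side_edge i \<sigma> j"
    by (auto simp: side_edge_def)
  then show "i = i' \<and> \<sigma> = \<sigma>' \<and> j = j'"
    using assms succ_neq[OF assms(1)] succ_neq[OF assms(3)] by (auto simp: mem_side_edge_iff)
qed simp

lemma incident_corner: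
  assumes "i < n"
  shows "{a \<in> graph_edges G. vertex (succ i) \<sigma> 0 \<in> a} =
    {rung (succ i), side_edge i \<sigma> (len i \<sigma> - 1), side_edge (succ i) \<sigma> 0}" (is "?L = ?R")
proof
  show "?L \<subseteq> ?R"
  proof
    fix a assume "a \<in> ?L"
    then have "a \<in> graph_edges G" and mem: "vertex (succ i) \<sigma> 0 \<in> a" by auto
    then show "a \<in> ?R"
    proof (cases rule: graph_edges_cases)
      case (rung i')
      then show ?thesis using mem by (simp add: mem_rung_iff succ_less len_pos)
    next
      case (side_edge i' \<tau> j)
      then have "\<tau> = \<sigma>" "i' = succ i \<and> j = 0 \<or> i' = i \<and> Suc j = len i \<sigma>"
        using mem assms by (auto simp: mem_side_edge_iff succ_less len_pos succ_inject)
      then have "i' = succ i \<and> j = 0 \<or> i' = i \<and> j = len i \<sigma> - 1" by linarith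
      then show ?thesis using side_edge \<open>\<tau> = \<sigma>\<close> by blast
    qed
  qed
  show "?R \<subseteq> ?L"
    using assms len_pos[of i \<sigma>]
    by (auto simp: rung_in_edges side_edge_in_edges succ_less len_pos mem_rung_iff
        mem_side_edge_iff)
qed

lemma incident_inner:
  assumes "i < n" "0 < j" "j < len i \<sigma>"
  shows "{a \<in> graph_edges G. vertex i \<sigma> j \<in> a} = {side_edge i \<sigma> (j - 1), side_edge i \<sigma> j}"
    (is "?L = ?R")
proof
  show "?L \<subseteq> ?R"
  proof
    fix a assume "a \<in> ?L"
    then have "a \<in> graph_edges G" and mem: "vertex i \<sigma> j \<in> a" by auto
    then show "a \<in> ?R"
      by (cases rule: graph_edges_cases) (use assms in \<open>auto simp: mem_rung_iff mem_side_edge_iff\<close>)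
  qed
  show "?R \<subseteq> ?L"
    using assms by (auto simp: side_edge_in_edges mem_side_edge_iff)
qed

lemma endpoint_cases:
  assumes "a \<in> graph_edges G" "v \<in> a"
  obtains (corner) i \<sigma> where "i < n" "v = vertex (succ i) \<sigma> 0"
  | (inner) i \<sigma> j where "i < n" "0 < j" "j < len i \<sigma>" "v = vertex i \<sigma> j"
proof -
  have vertex_case: thesis if ij: "i < n" "j \<le> len i \<sigma>" "v = vertex i \<sigma> j" for i \<sigma> j
  proof -
    consider (first) "j = 0" | (interior) "0 < j" "j < len i \<sigma>" | (last) "j = len i \<sigma>"
      using ij(2) by linarith
    then show thesis
    proof cases
      case first
      then show thesis using succ_surj[OF ij(1)] ij(3) corner by metis
    next
      case interior
      then show thesis using inner ij by blast
    next
      case last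
      then show thesis using corner vertex_len ij unfolding succ_def by metis
    qed
  qed
  from assms(1) show thesis
  proof (cases rule: graph_edges_cases)
    case (rung i)
    then obtain \<sigma> where "v = vertex i \<sigma> 0"
      using assms(2) by (auto simp: rung_def)
    then show thesis using vertex_case[of i 0 \<sigma>] rung by simp
  next
    case (side_edge i \<sigma> j)
    then have "v = vertex i \<sigma> j \<or> v = vertex i \<sigma> (Suc j)"
      using assms(2) by (simp add: side_edge_def)
    then show thesis using vertex_case[of i j \<sigma>] vertex_case[of i "Suc j" \<sigma>] side_edge by auto
  qed
qed

lemma mem_Union_iff: "M \<subseteq> graph_edges G \<Longrightarrow> v \<in> \<Union>M \<longleftrightarrow> {a \<in> graph_edges G. v \<in> a} \<inter> M \<noteq> {}"
  by auto

lemma corner_covered_iff: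
  "M \<subseteq> graph_edges G \<Longrightarrow> i < n \<Longrightarrow> vertex (succ i) \<sigma> 0 \<in> \<Union>M \<longleftrightarrow>
    rung (succ i) \<in> M \<or> side_edge i \<sigma> (len i \<sigma> - 1) \<in> M \<or> side_edge (succ i) \<sigma> 0 \<in> M"
  by (simp only: mem_Union_iff incident_corner) auto

lemma inner_covered_iff:
  "M \<subseteq> graph_edges G \<Longrightarrow> i < n \<Longrightarrow> 0 < j \<Longrightarrow> j < len i \<sigma> \<Longrightarrow>
    vertex i \<sigma> j \<in> \<Union>M \<longleftrightarrow> side_edge i \<sigma> (j - 1) \<in> M \<or> side_edge i \<sigma> j \<in> M"
  by (simp only: mem_Union_iff incident_inner) auto

lemma state_Unmatched_iff: "state M i \<sigma> = Unmatched \<longleftrightarrow> vertex i \<sigma> 0 \<notin> \<Union>M"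
  by (cases \<sigma>) (auto simp: state_def rung_def side_edge_def)

lemma valid_state_iff_rung_covered: "valid_state (state M i) \<longleftrightarrow> rung i \<inter> \<Union>M \<noteq> {}"
proof -
  have "state M i Left = Crossing \<longleftrightarrow> state M i Right = Crossing"
    by (simp add: state_def)
  then show ?thesis
    by (auto simp: valid_state_def ex_side_iff state_Unmatched_iff rung_def)
qed

lemma path_covered_iff:
  assumes "M \<subseteq> graph_edges G" "i < n" "j \<le> len i \<sigma>"
  shows "path_covered (len i \<sigma>) (\<lambda>j. side_edge i \<sigma> j \<in> M) (state M i \<sigma>) (state M (succ i) \<sigma>) j \<longleftrightarrow>
    vertex i \<sigma> j \<in> \<Union>M"
  using assms vertex_len[of i \<sigma>]
  by (auto simp: path_covered_def state_Unmatched_iff succ_def inner_covered_iff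
      simp del: Union_iff)

lemma matching_at_iff:
  assumes "M \<subseteq> graph_edges G"
  shows "(\<exists>\<^sub>\<le>\<^sub>1 a. a \<in> M \<and> v \<in> a) \<longleftrightarrow>
    (\<forall>a\<in>{a \<in> graph_edges G. v \<in> a}. \<forall>b\<in>{a \<in> graph_edges G. v \<in> a}. a \<noteq> b \<longrightarrow> \<not> (a \<in> M \<and> b \<in> M))"
  using assms by (auto simp: Uniq_def)

lemma matching_at_corner_iff:
  assumes "M \<subseteq> graph_edges G" "i < n"
  shows "(\<exists>\<^sub>\<le>\<^sub>1 a. a \<in> M \<and> vertex (succ i) \<sigma> 0 \<in> a) \<longleftrightarrow>
    (side_edge (succ i) \<sigma> 0 \<in> M \<longleftrightarrow> state M (succ i) \<sigma> = Forward) \<and>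
    (side_edge i \<sigma> (len i \<sigma> - 1) \<in> M \<longleftrightarrow> state M (succ i) \<sigma> = Backward)"
proof -
  have distinct_edges: "rung (succ i) \<noteq> side_edge i \<sigma> (len i \<sigma> - 1)"
    "rung (succ i) \<noteq> side_edge (succ i) \<sigma> 0"
    "side_edge i \<sigma> (len i \<sigma> - 1) \<noteq> side_edge (succ i) \<sigma> 0"
    using assms len_pos[of i \<sigma>] succ_neq(1)[of i]
    by (simp_all add: rung_neq_side_edge side_edge_inject succ_less len_pos)
  show ?thesis
    unfolding matching_at_iff[OF assms(1)] incident_corner[OF assms(2)] state_def
      corner_covered_iff[OF assms]
    using distinct_edges by auto
qed

lemma matching_at_inner_iff:
  assumes "M \<subseteq> graph_edges G" "i < n" "0 < j" "j < len i \<sigma>"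
  shows "(\<exists>\<^sub>\<le>\<^sub>1 a. a \<in> M \<and> vertex i \<sigma> j \<in> a) \<longleftrightarrow> \<not> (side_edge i \<sigma> (j - 1) \<in> M \<and> side_edge i \<sigma> j \<in> M)"
proof -
  have "side_edge i \<sigma> (j - 1) \<noteq> side_edge i \<sigma> j"
    using assms by (simp add: side_edge_inject)
  then show ?thesis
    unfolding matching_at_iff[OF assms(1)] incident_inner[OF assms(2-4)] by auto
qed

lemma matching_iff_vertices:
  assumes "M \<subseteq> graph_edges G"
  shows "(\<forall>v. \<exists>\<^sub>\<le>\<^sub>1 a. a \<in> M \<and> v \<in> a) \<longleftrightarrow> (\<forall>i<n. \<forall>\<sigma>. (\<exists>\<^sub>\<le>\<^sub>1 a. a \<in> M \<and> vertex (succ i) \<sigma> 0 \<in> a) \<and>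
    (\<forall>j\<in>{0<..<len i \<sigma>}. \<exists>\<^sub>\<le>\<^sub>1 a. a \<in> M \<and> vertex i \<sigma> j \<in> a))" (is "_ \<longleftrightarrow> ?vertices")
proof (intro iffI allI)
  fix v
  assume ?vertices
  show "\<exists>\<^sub>\<le>\<^sub>1 a. a \<in> M \<and> v \<in> a"
  proof (cases "\<exists>a\<in>M. v \<in> a")
    case True
    then obtain a where "a \<in> graph_edges G" "v \<in> a" using assms by blast
    then show ?thesis
      by (cases rule: endpoint_cases) (use \<open>?vertices\<close> in simp_all)
  next
    case False
    then show ?thesis by (auto simp: Uniq_def)
  qed
qed simp

lemma matching_iff:
  assumes "M \<subseteq> graph_edges G"
  shows "(\<forall>v. \<exists>\<^sub>\<le>\<^sub>1 a. a \<in> M \<and> v \<in> a) \<longleftrightarrow> (\<forall>i<n. \<forall>\<sigma>.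
    (side_edge i \<sigma> 0 \<in> M \<longleftrightarrow> state M i \<sigma> = Forward) \<and>
    (side_edge i \<sigma> (len i \<sigma> - 1) \<in> M \<longleftrightarrow> state M (succ i) \<sigma> = Backward) \<and>
    (\<forall>j\<in>{0<..<len i \<sigma>}. \<not> (side_edge i \<sigma> (j - 1) \<in> M \<and> side_edge i \<sigma> j \<in> M)))"
proof -
  have "(\<forall>i<n. \<forall>\<sigma>. side_edge (succ i) \<sigma> 0 \<in> M \<longleftrightarrow> state M (succ i) \<sigma> = Forward) \<longleftrightarrow>
      (\<forall>i<n. \<forall>\<sigma>. side_edge i \<sigma> 0 \<in> M \<longleftrightarrow> state M i \<sigma> = Forward)"
    by (rule all_succ_iff)
  moreover have "(\<forall>v. \<exists>\<^sub>\<le>\<^sub>1 a. a \<in> M \<and> v \<in> a) \<longleftrightarrow> (\<forall>i<n. \<forall>\<sigma>.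
      (side_edge (succ i) \<sigma> 0 \<in> M \<longleftrightarrow> state M (succ i) \<sigma> = Forward) \<and>
      (side_edge i \<sigma> (len i \<sigma> - 1) \<in> M \<longleftrightarrow> state M (succ i) \<sigma> = Backward) \<and>
      (\<forall>j\<in>{0<..<len i \<sigma>}. \<not> (side_edge i \<sigma> (j - 1) \<in> M \<and> side_edge i \<sigma> j \<in> M)))"
    unfolding matching_iff_vertices[OF assms]
    by (simp add: matching_at_corner_iff[OF assms] matching_at_inner_iff[OF assms])
  ultimately show ?thesis by blast
qed

lemma dominating_iff:
  assumes "M \<subseteq> graph_edges G"
  shows "(\<forall>a\<in>graph_edges G. a \<inter> \<Union>M \<noteq> {}) \<longleftrightarrow>
    (\<forall>i<n. valid_state (state M i)) \<and> (\<forall>i<n. \<forall>\<sigma>. \<forall>j<len i \<sigma>.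
      let cov = path_covered (len i \<sigma>) (\<lambda>j. side_edge i \<sigma> j \<in> M) (state M i \<sigma>) (state M (succ i) \<sigma>)
      in cov j \<or> cov (Suc j))"
proof -
  have "(\<forall>a\<in>graph_edges G. a \<inter> \<Union>M \<noteq> {}) \<longleftrightarrow>
      (\<forall>i<n. rung i \<inter> \<Union>M \<noteq> {}) \<and> (\<forall>i<n. \<forall>\<sigma>. \<forall>j<len i \<sigma>. side_edge i \<sigma> j \<inter> \<Union>M \<noteq> {})"
    by (blast intro: rung_in_edges side_edge_in_edges elim: graph_edges_cases)
  also have "(\<forall>i<n. \<forall>\<sigma>. \<forall>j<len i \<sigma>. side_edge i \<sigma> j \<inter> \<Union>M \<noteq> {}) \<longleftrightarrow>
      (\<forall>i<n. \<forall>\<sigma>. \<forall>j<len i \<sigma>. vertex i \<sigma> j \<in> \<Union>M \<or> vertex i \<sigma> (Suc j) \<in> \<Union>M)"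
    by (simp add: side_edge_def del: Union_iff)
  finally show ?thesis
    using assms by (simp add: valid_state_iff_rung_covered path_covered_iff Let_def)
qed

lemma is_maximal_matching_iff_state:
  "is_maximal_matching G M \<longleftrightarrow> M \<subseteq> graph_edges G \<and> (\<forall>i<n. valid_state (state M i)) \<and>
    (\<forall>i<n. \<forall>\<sigma>. path_matching (len i \<sigma>) (\<lambda>j. side_edge i \<sigma> j \<in> M)
      (state M i \<sigma>) (state M (succ i) \<sigma>))"
proof (cases "M \<subseteq> graph_edges G")
  case True
  show ?thesis
    unfolding is_maximal_matching_iff matching_iff[OF True] dominating_iff[OF True]
      path_matching_def Let_def
    by blast
qed (simp add: is_maximal_matching_iff)

lemma maximal_matching_eqI:
  assumes M: "is_maximal_matching G M" and M': "is_maximal_matching G M'"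
    and len: "\<And>i \<sigma>. i < n \<Longrightarrow> len i \<sigma> \<le> 3"
    and state: "\<And>i. i < n \<Longrightarrow> state M i = state M' i"
  shows "M = M'"
proof -
  have "a \<in> M \<longleftrightarrow> a \<in> M'" if "a \<in> graph_edges G" for a
    using that
  proof (cases rule: graph_edges_cases)
    case (rung i)
    have "rung i \<in> N \<longleftrightarrow> state N i Left = Crossing" for N
      by (simp add: state_def)
    then show ?thesis using rung state by simp
  next
    case (side_edge i \<sigma> j)
    have "path_matching (len i \<sigma>) (\<lambda>j. side_edge i \<sigma> j \<in> N) (state M i \<sigma>) (state M (succ i) \<sigma>)"
      if "N = M \<or> N = M'" for N
      using that M M' side_edge(1) state succ_less unfolding is_maximal_matching_iff_state by metis
    from path_matching_unique[OF this[of M] this[of M'] len[OF side_edge(1)] side_edge(2)]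
    show ?thesis using side_edge(3) by simp
  qed
  moreover have "M \<subseteq> graph_edges G" "M' \<subseteq> graph_edges G"
    using M M' by (simp_all add: is_maximal_matching_iff)
  ultimately show ?thesis by blast
qed

lemma ex_maximal_matching_state:
  assumes valid_state: "\<And>i. i < n \<Longrightarrow> valid_state (s i)"
    and step: "\<And>i \<sigma>. i < n \<Longrightarrow> side_step (len i \<sigma>) (s i \<sigma>) (s (succ i) \<sigma>)"
  obtains M where "is_maximal_matching G M" "\<And>i. i < n \<Longrightarrow> state M i = s i"
proof -
  define y where "y i \<sigma> = (SOME y. path_matching (len i \<sigma>) y (s i \<sigma>) (s (succ i) \<sigma>))" for i \<sigma>
  have y: "path_matching (len i \<sigma>) (y i \<sigma>) (s i \<sigma>) (s (succ i) \<sigma>)" if "i < n" for i \<sigma>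
    unfolding y_def using step[OF that] unfolding side_step_def by (rule someI_ex)
  define M where
    "M = {rung i | i. i < n \<and> s i Left = Crossing} \<union>
      {side_edge i \<sigma> j | i \<sigma> j. i < n \<and> j < len i \<sigma> \<and> y i \<sigma> j}"
  have sub: "M \<subseteq> graph_edges G"
    by (auto simp: M_def rung_in_edges side_edge_in_edges)
  have side_edge_iff: "side_edge i \<sigma> j \<in> M \<longleftrightarrow> y i \<sigma> j" if "i < n" "j < len i \<sigma>" for i \<sigma> j
    using that by (auto simp: M_def side_edge_inject rung_neq_side_edge[symmetric])
  have rung_iff: "rung i \<in> M \<longleftrightarrow> s i \<sigma> = Crossing" if "i < n" for i \<sigma>
  proof -
    have "rung i \<in> M \<longleftrightarrow> s i Left = Crossing"
      using that by (auto simp: M_def rung_inject rung_neq_side_edge)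
    then show ?thesis using valid_state[OF that] by (cases \<sigma>) (auto simp: valid_state_def)
  qed
  have state_succ: "state M (succ i) \<sigma> = s (succ i) \<sigma>" if "i < n" for i \<sigma>
  proof -
    have "side_edge (succ i) \<sigma> 0 \<in> M \<longleftrightarrow> s (succ i) \<sigma> = Forward"
      using y[OF succ_less, of i \<sigma>] by (simp add: side_edge_iff succ_less len_pos path_matching_def)
    moreover have "side_edge i \<sigma> (len i \<sigma> - 1) \<in> M \<longleftrightarrow> s (succ i) \<sigma> = Backward"
      using y[OF that, of \<sigma>] that len_pos[OF that] by (simp add: side_edge_iff path_matching_def)
    ultimately show ?thesis
      unfolding state_def corner_covered_iff[OF sub that] rung_iff[OF succ_less, of _ \<sigma>]
      by (cases "s (succ i) \<sigma>") auto
  qed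
  have state: "state M i = s i" if "i < n" for i
    by (rule succ_surj[OF that]) (simp add: state_succ fun_eq_iff)
  have "path_matching (len i \<sigma>) (\<lambda>j. side_edge i \<sigma> j \<in> M) (s i \<sigma>) (s (succ i) \<sigma>)" if "i < n" for i \<sigma>
    using y[OF that] side_edge_iff[OF that] len_pos[OF that] by (simp cong: path_matching_cong)
  then have "is_maximal_matching G M"
    using sub valid_state by (simp add: is_maximal_matching_iff_state state succ_less)
  then show thesis using that state by blast
qed

lemma bij_betw_maximal_matchings_closed_walks:
  assumes "length ms = n" and len_eq: "\<And>i. i < n \<Longrightarrow> len i = side_length (ms ! i)"
  shows "bij_betw (\<lambda>M. map (state M) [0..<n]) {M. is_maximal_matching G M}
    (closed_walks (Collect valid_state) hexagon_step ms)" (is "bij_betw ?f ?A ?B")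
proof (intro bij_betw_imageI equalityI)
  have step_iff: "hexagon_step (ms ! i) s t \<longleftrightarrow> (\<forall>\<sigma>. side_step (len i \<sigma>) (s \<sigma>) (t \<sigma>))"
    if "i < n" for i s t
    using that by (simp add: hexagon_step_def len_eq all_side_iff)
  show "inj_on ?f ?A"
  proof (rule inj_onI)
    fix M M' assume "M \<in> ?A" "M' \<in> ?A" "?f M = ?f M'"
    moreover have "len i \<sigma> \<le> 3" if "i < n" for i \<sigma>
      unfolding len_eq[OF that] by (cases "ms ! i"; cases \<sigma>) auto
    ultimately show "M = M'" by (intro maximal_matching_eqI) auto
  qed
  show "?f ` ?A \<subseteq> ?B"
  proof (intro image_subsetI)
    fix M assume "M \<in> ?A"
    then have "valid_state (state M i)" "hexagon_step (ms ! i) (state M i) (state M (succ i))"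
      if "i < n" for i
      using that unfolding step_iff[OF that] mem_Collect_eq is_maximal_matching_iff_state
        side_step_def by blast+
    then show "?f M \<in> ?B"
      using assms(1) succ_less by (auto simp: closed_walks_def succ_def)
  qed
  show "?B \<subseteq> ?f ` ?A"
  proof
    fix xs assume "xs \<in> ?B"
    then have xs: "length xs = n" "set xs \<subseteq> Collect valid_state"
      "\<And>i. i < n \<Longrightarrow> hexagon_step (ms ! i) (xs ! i) (xs ! succ i)"
      using assms(1) by (simp_all add: closed_walks_def succ_def)
    have "valid_state (xs ! i)" if "i < n" for i
      using xs(1,2) nth_mem that by blast
    then obtain M where "is_maximal_matching G M" "\<And>i. i < n \<Longrightarrow> state M i = xs ! i"
      by (rule ex_maximal_matching_state[of "(!) xs"]) (use xs(3) step_iff in auto)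
    then have "M \<in> ?A" "xs = ?f M"
      using xs(1) by (auto intro: nth_equalityI)
    then show "xs \<in> ?f ` ?A" by blast
  qed
qed

end

section \<open>Faces of a rotation system\<close>

locale rotation_system = pair_graph G for G :: "'a pair_pre_digraph" +
  fixes rot :: "'a \<times> 'a \<Rightarrow> 'a \<times> 'a"
  assumes rot_permutes: "rot permutes parcs G"
    and fst_rot: "d \<in> parcs G \<Longrightarrow> fst (rot d) = fst d"
begin

abbreviation next_dart :: "'a \<times> 'a \<Rightarrow> 'a \<times> 'a" where
  "next_dart \<equiv> face_step rot"

lemma face_step_in_arcs: "d \<in> parcs G \<Longrightarrow> next_dart d \<in> parcs G"
  using arcs_symmetric permutes_in_image[OF rot_permutes] by (cases d) (simp add: face_step_def)

lemma fst_face_step: "d \<in> parcs G \<Longrightarrow> fst (next_dart d) = snd d"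
  using arcs_symmetric fst_rot by (cases d) (simp add: face_step_def)

lemma inj_face_step: "inj next_dart"
  unfolding face_step_def using permutes_inj[OF rot_permutes] by (intro inj_compose) simp_all

lemma face_subset_arcs:
  assumes "F \<in> faces G rot"
  shows "F \<subseteq> parcs G"
proof -
  obtain d where d: "d \<in> parcs G" "F = orbit next_dart d"
    using assms by (auto simp: faces_def)
  have "x \<in> parcs G" if "x \<in> orbit next_dart d" for x
    using that by induction (simp_all add: d(1) face_step_in_arcs)
  then show ?thesis using d(2) by blast
qed

lemma orbit_face:
  assumes "F \<in> faces G rot" "d \<in> F"
  shows "orbit next_dart d = F"
proof -
  obtain c where c: "c \<in> parcs G" "F = orbit next_dart c"
    using assms(1) by (auto simp: faces_def)
  have "(next_dart ^^ j) c \<in> parcs G" for j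
    by (induction j) (simp_all add: c(1) face_step_in_arcs)
  then have "finite {y. \<exists>j. y = (next_dart ^^ j) c}"
    by (intro finite_subset[OF _ pair_finite_arcs]) auto
  then obtain j where "0 < j" "(next_dart ^^ j) c = c"
    using funpow_inj_finite[OF inj_face_step] by metis
  then have "c \<in> orbit next_dart c"
    by (auto simp: orbit_altdef intro: sym)
  then have "cyclic_on next_dart F"
    using c(2) by (auto simp: cyclic_on_def)
  then show ?thesis using assms(2) by (rule orbit_cyclic_eq3)
qed

lemma funpow_face_step_in_face:
  assumes "F \<in> faces G rot" "d \<in> F"
  shows "(next_dart ^^ j) d \<in> F"
proof (induction j)
  case (Suc j)
  then have "next_dart ((next_dart ^^ j) d) \<in> orbit next_dart d"
    using orbit_face[OF assms] by (auto intro: orbit.step)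
  then show ?case using orbit_face[OF assms] by simp
qed (simp add: assms(2))

lemma
  assumes "F \<in> faces G rot" "d \<in> F"
  shows bij_betw_face: "bij_betw (\<lambda>j. (next_dart ^^ j) d) {..<card F} F"
    and funpow_card_face: "(next_dart ^^ card F) d = d"
proof -
  have self: "d \<in> orbit next_dart d"
    using assms by (simp add: orbit_face)
  have "bij_betw (\<lambda>j. (next_dart ^^ j) d) {..<funpow_dist1 next_dart d d} F"
    using orbit_conv_funpow_dist1[OF self] inj_on_funpow_dist1[OF self] orbit_face[OF assms]
    by (simp add: bij_betw_def atLeast0LessThan)
  moreover from this have "funpow_dist1 next_dart d d = card F"
    by (auto dest: bij_betw_same_card)
  ultimately show "bij_betw (\<lambda>j. (next_dart ^^ j) d) {..<card F} F" "(next_dart ^^ card F) d = d"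
    using funpow_dist1_prop[OF self] by simp_all
qed

lemma face_eqI: "F \<in> faces G rot \<Longrightarrow> F' \<in> faces G rot \<Longrightarrow> d \<in> F \<Longrightarrow> d \<in> F' \<Longrightarrow> F = F'"
  using orbit_face by metis

lemma inj_on_dart_edge_face:
  assumes F: "F \<in> faces G rot" and inj: "inj_on fst F" and card: "3 \<le> card F"
  shows "inj_on dart_edge F"
proof (rule inj_onI, rule ccontr)
  fix c d assume c: "c \<in> F" and d: "d \<in> F" and eq: "dart_edge c = dart_edge d" and "c \<noteq> d"
  then have "fst c \<noteq> fst d" using inj by (auto dest: inj_onD)
  then have swap: "fst d = snd c" "fst c = snd d"
    using eq by (auto simp: dart_edge_def doubleton_eq_iff)
  have next_eq: "next_dart x = y" if "x \<in> F" "y \<in> F" "snd x = fst y" for x y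
  proof (rule inj_onD[OF inj])
    show "fst (next_dart x) = fst y"
      using that fst_face_step[of x] face_subset_arcs[OF F] by auto
    show "next_dart x \<in> F"
      using funpow_face_step_in_face[OF F that(1), of 1] by simp
  qed (rule that(2))
  have "(next_dart ^^ 2) c = (next_dart ^^ 0) c"
    using next_eq[of c d] next_eq[of d c] c d swap by (simp add: numeral_2_eq_2)
  then show False
    using bij_betw_face[OF F c] card unfolding bij_betw_def
    by (auto dest: inj_onD[of _ _ 2 0])
qed

lemma funpow_edges_between:
  assumes F: "F \<in> faces G rot" and inj: "inj_on dart_edge F" and "c \<in> F" "d \<in> F"
  shows "(next_dart ^^ Suc (edges_between rot F (dart_edge c) (dart_edge d))) c = d"
proof -
  have the_dart: "(THE x. x \<in> F \<and> dart_edge x = dart_edge y) = y" if "y \<in> F" for y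
    using that inj by (intro the_equality) (auto dest: inj_onD)
  have "d \<in> orbit next_dart (next_dart c)"
    using orbit_face[OF F funpow_face_step_in_face[OF F \<open>c \<in> F\<close>, of 1]] \<open>d \<in> F\<close> by simp
  then show ?thesis
    using assms(3,4) by (simp add: edges_between_def the_dart funpow_swap1 funpow_dist_prop)
qed

end

lemma rotation_system_if_plane_graph:
  assumes "plane_graph G rot"
  shows "rotation_system G rot"
proof -
  interpret pair_graph G using assms by (simp add: plane_graph_def)
  show ?thesis
  proof
    show "rot permutes parcs G" using assms by (simp add: plane_graph_def)
    fix d assume "d \<in> parcs G"
    then have out: "d \<in> out_arcs (with_proj G) (fst d)" by (simp add: out_arcs_def)
    have "fst d \<in> pverts G" using \<open>d \<in> parcs G\<close> by (rule arc_fst_in_verts)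
    then have "cyclic_on rot (out_arcs (with_proj G) (fst d))"
      using assms out unfolding plane_graph_def by blast
    then have "rot d \<in> out_arcs (with_proj G) (fst d)" using out by (rule cyclic_on_inI)
    then show "fst (rot d) = fst d" by simp
  qed
qed

section \<open>Hexagonal rings as cyclic ladders\<close>

locale typed_hexagonal_ring =
  fixes G :: "'a pair_pre_digraph" and rot :: "'a \<times> 'a \<Rightarrow> 'a \<times> 'a" and n :: nat
    and H :: "nat \<Rightarrow> ('a \<times> 'a) set" and e :: "nat \<Rightarrow> 'a set" and Ms :: "attachment list"
  assumes ring: "hexagonal_ring G rot n H e"
    and type: "has_ring_type rot n H e Ms"
begin

abbreviation left_length :: "nat \<Rightarrow> nat" where
  "left_length i \<equiv> attachment_size (Ms ! i)"

sublocale rotation_system G rot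
  using ring rotation_system_if_plane_graph by (auto simp: hexagonal_ring_def)

lemma three_le: "3 \<le> n"
  using ring by (simp add: hexagonal_ring_def)

lemma length_Ms: "length Ms = n"
  using type by (simp add: has_ring_type_def)

lemma Suc_mod_less: "Suc i mod n < n"
  using three_le by simp

lemma graph_edges_eq_UN: "graph_edges G = (\<Union>i<n. face_edges (H i))"
  using ring by (simp add: hexagonal_ring_def)

lemma
  assumes "i < n"
  shows hexagon_in_faces: "H i \<in> faces G rot"
    and card_hexagon: "card (H i) = 6"
    and inj_on_fst_hexagon: "inj_on fst (H i)"
    and inj_on_dart_edge_hexagon: "inj_on dart_edge (H i)"
proof -
  show face: "H i \<in> faces G rot" and card: "card (H i) = 6"
    using ring assms by (simp_all add: hexagonal_ring_def is_hexagon_def)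
  have "card (fst ` H i) = card (H i)"
    using ring assms by (simp add: hexagonal_ring_def is_hexagon_def face_verts_def)
  then show "inj_on fst (H i)"
    by (intro eq_card_imp_inj_on) (simp_all add: card card_ge_0_finite)
  then show "inj_on dart_edge (H i)"
    using face card by (intro inj_on_dart_edge_face) simp_all
qed

lemma
  assumes "i < n"
  shows common_edge_hexagons: "face_edges (H i) \<inter> face_edges (H (Suc i mod n)) = {e (Suc i mod n)}"
    and common_verts_hexagons: "face_verts (H i) \<inter> face_verts (H (Suc i mod n)) = e (Suc i mod n)"
  using ring assms by (simp_all add: hexagonal_ring_def)

lemma disjoint_hexagons:
  assumes "i < n" "j < n" "i \<noteq> j" "j \<noteq> Suc i mod n" "i \<noteq> Suc j mod n"
  shows "face_verts (H i) \<inter> face_verts (H j) = {}"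
  using ring assms by (simp add: hexagonal_ring_def)

lemma shared_edge_in_face_edges:
  assumes "i < n"
  shows "e i \<in> face_edges (H i)" "e (Suc i mod n) \<in> face_edges (H i)"
proof -
  obtain i' where "i' < n" "i = Suc i' mod n"
    using assms by (rule Suc_mod_surjE)
  then show "e i \<in> face_edges (H i)" using common_edge_hexagons[of i'] by blast
  show "e (Suc i mod n) \<in> face_edges (H i)" using common_edge_hexagons[OF assms] by blast
qed

definition dart :: "nat \<Rightarrow> nat \<Rightarrow> 'a \<times> 'a" where
  "dart i j = (next_dart ^^ j) (THE d. d \<in> H i \<and> dart_edge d = e i)"

definition corner :: "nat \<Rightarrow> nat \<Rightarrow> 'a" where
  "corner i j = snd (dart i j)"

lemma
  assumes "i < n"
  shows first_dart_in_hexagon: "dart i 0 \<in> H i"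
    and dart_edge_first_dart: "dart_edge (dart i 0) = e i"
proof -
  obtain d where d: "d \<in> H i" "dart_edge d = e i"
    using shared_edge_in_face_edges(1)[OF assms] by (auto simp: face_edges_def)
  then have "(THE d. d \<in> H i \<and> dart_edge d = e i) = d"
    using inj_on_dart_edge_hexagon[OF assms] by (intro the_equality) (auto dest: inj_onD)
  then show "dart i 0 \<in> H i" "dart_edge (dart i 0) = e i" using d by (simp_all add: dart_def)
qed

lemma dart_add: "dart i (j + l) = (next_dart ^^ j) (dart i l)"
  by (simp add: dart_def funpow_add)

lemma dart_Suc: "dart i (Suc j) = next_dart (dart i j)"
  by (simp add: dart_def)

lemma dart_in_hexagon: "i < n \<Longrightarrow> dart i j \<in> H i"
  using funpow_face_step_in_face[OF hexagon_in_faces first_dart_in_hexagon] dart_add[of i j 0]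
  by simp

lemma dart_6: "i < n \<Longrightarrow> dart i 6 = dart i 0"
  using funpow_card_face[OF hexagon_in_faces first_dart_in_hexagon] card_hexagon
    dart_add[of i 6 0] by simp

lemma bij_betw_dart: "i < n \<Longrightarrow> bij_betw (\<lambda>j. dart i (j + l)) {..<6} (H i)"
  using bij_betw_face[OF hexagon_in_faces dart_in_hexagon] card_hexagon
  by (simp add: dart_add)

lemma fst_dart_Suc: "i < n \<Longrightarrow> fst (dart i (Suc j)) = corner i j"
  using fst_face_step[of "dart i j"] face_subset_arcs[OF hexagon_in_faces] dart_in_hexagon
  by (auto simp: corner_def dart_Suc)

lemma dart_edge_dart_0: "i < n \<Longrightarrow> dart_edge (dart i 0) = {corner i 0, corner i 5}"
  using fst_dart_Suc[of i 5] by (auto simp: dart_edge_def corner_def dart_6)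

lemma dart_edge_dart_Suc: "i < n \<Longrightarrow> dart_edge (dart i (Suc j)) = {corner i j, corner i (Suc j)}"
  by (simp add: dart_edge_def fst_dart_Suc) (simp add: corner_def)

lemma bij_betw_corner:
  assumes "i < n"
  shows "bij_betw (corner i) {..<6} (face_verts (H i))"
proof -
  have "bij_betw (fst \<circ> (\<lambda>j. dart i (j + 1))) {..<6} (fst ` H i)"
    using bij_betw_dart[OF assms, of 1] inj_on_fst_hexagon[OF assms]
    by (intro bij_betw_trans[of _ _ "H i"]) (auto intro: inj_on_imp_bij_betw)
  then show ?thesis
    using assms by (simp add: comp_def fst_dart_Suc face_verts_def)
qed

lemma face_edges_hexagon:
  assumes "i < n"
  shows "face_edges (H i) = (\<lambda>j. dart_edge (dart i j)) ` {..<6}"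
proof -
  have "H i = dart i ` {..<6}"
    using bij_betw_imp_surj_on[OF bij_betw_dart[OF assms, of 0]] by simp
  then show ?thesis by (simp add: face_edges_def image_image)
qed

lemma last_dart_edge:
  assumes "i < n"
  shows "dart_edge (dart i (Suc (left_length i))) = e (Suc i mod n)"
proof -
  obtain d where d: "d \<in> H i" "dart_edge d = e (Suc i mod n)"
    using shared_edge_in_face_edges(2)[OF assms] by (auto simp: face_edges_def)
  have "edges_between rot (H i) (e i) (e (Suc i mod n)) = left_length i"
    using type assms by (simp add: has_ring_type_def)
  then have "dart i (Suc (left_length i)) = d"
    using funpow_edges_between[OF hexagon_in_faces[OF assms] inj_on_dart_edge_hexagon[OF assms]
        first_dart_in_hexagon[OF assms] d(1)]
    by (simp add: dart_edge_first_dart[OF assms] d(2) dart_Suc flip: dart_add)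
  then show ?thesis using d by simp
qed

text \<open>Distinct faces contain opposite darts of a common edge, so the ring is not twisted.\<close>

lemma last_dart_eq_swap:
  assumes "i < n"
  shows "dart i (Suc (left_length i)) = prod.swap (dart (Suc i mod n) 0)"
    (is "?c = prod.swap ?d")
proof -
  have "?c \<noteq> ?d"
  proof
    assume "?c = ?d"
    then have "H i = H (Suc i mod n)"
      using face_eqI hexagon_in_faces dart_in_hexagon assms Suc_mod_less by metis
    then have "card (face_edges (H i)) = 1"
      using common_edge_hexagons[OF assms] by simp
    then show False
      using card_image[OF inj_on_dart_edge_hexagon[OF assms]] card_hexagon[OF assms]
      by (simp add: face_edges_def)
  qed
  moreover have "dart_edge ?c = dart_edge ?d"
    using last_dart_edge[OF assms] dart_edge_first_dart[OF Suc_mod_less] by simp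
  ultimately show ?thesis
    by (cases ?c; cases ?d) (auto simp: dart_edge_def doubleton_eq_iff)
qed

lemma corner_shared:
  assumes "i < n"
  shows "corner i (left_length i) = corner (Suc i mod n) 0"
    and "corner i (Suc (left_length i)) = corner (Suc i mod n) 5"
proof -
  show "corner i (left_length i) = corner (Suc i mod n) 0"
    using fst_dart_Suc[OF assms, of "left_length i"] last_dart_eq_swap[OF assms]
    by (simp add: corner_def)
  show "corner i (Suc (left_length i)) = corner (Suc i mod n) 5"
    using fst_dart_Suc[OF Suc_mod_less, of i 5] last_dart_eq_swap[OF assms]
    by (simp add: corner_def dart_6[OF Suc_mod_less])
qed

lemma common_corner:
  assumes "i < n" "j < 6" "j' < 6" "corner i j = corner (Suc i mod n) j'"
  shows "j = left_length i \<or> j = Suc (left_length i)"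
proof -
  let ?k = "left_length i"
  have "corner i j \<in> face_verts (H i)" "corner (Suc i mod n) j' \<in> face_verts (H (Suc i mod n))"
    using bij_betw_apply[OF bij_betw_corner] assms(1-3) Suc_mod_less by simp_all
  then have "corner i j \<in> dart_edge (dart i (Suc ?k))"
    using assms(4) common_verts_hexagons[OF assms(1)] last_dart_edge[OF assms(1)] by auto
  then have "corner i j = corner i ?k \<or> corner i j = corner i (Suc ?k)"
    by (simp add: dart_edge_dart_Suc assms(1))
  moreover have "?k < 6" "Suc ?k < 6" by (cases "Ms ! i"; simp)+
  ultimately show ?thesis
    using bij_betw_imp_inj_on[OF bij_betw_corner[OF assms(1)]] assms(2) by (auto dest: inj_onD)
qed

lemma corner_inject:
  assumes "i < n" "j < 6" "j \<notin> {left_length i, Suc (left_length i)}"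
    and "i' < n" "j' < 6" "j' \<notin> {left_length i', Suc (left_length i')}"
    and eq: "corner i j = corner i' j'"
  shows "i = i' \<and> j = j'"
proof -
  have "corner i j \<in> face_verts (H i)" "corner i' j' \<in> face_verts (H i')"
    using bij_betw_apply[OF bij_betw_corner] assms(1,2,4,5) by auto
  then consider (same) "i = i'" | (successor) "i' = Suc i mod n" | (predecessor) "i = Suc i' mod n"
    using disjoint_hexagons[OF assms(1,4)] eq by auto
  then show ?thesis
  proof cases
    case same
    then show ?thesis
      using bij_betw_imp_inj_on[OF bij_betw_corner[OF assms(1)]] assms(2,5) eq
      by (auto dest: inj_onD)
  next
    case successor
    then show ?thesis using common_corner[of i j j'] assms by auto
  next
    case predecessor
    then show ?thesis using common_corner[of i' j' j] assms by auto
  qed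
qed

text \<open>With \<open>k = left_length i\<close>, corners \<open>0, \<dots>, k\<close> of hexagon \<open>i\<close> form its left side, and corners
  \<open>5, \<dots>, k + 1\<close>, in this order, its right side.\<close>

fun side_corner :: "side \<Rightarrow> nat \<Rightarrow> nat" where
  "side_corner Left j = j"
| "side_corner Right j = 5 - j"

definition side_vertex :: "nat \<Rightarrow> side \<Rightarrow> nat \<Rightarrow> 'a" where
  "side_vertex i \<sigma> j = corner i (side_corner \<sigma> j)"

lemma rung_eq_dart_edge:
  "i < n \<Longrightarrow> {side_vertex i Left 0, side_vertex i Right 0} = dart_edge (dart i 0)"
  by (simp add: side_vertex_def dart_edge_dart_0)

lemma left_edge_eq_dart_edge:
  "i < n \<Longrightarrow> {side_vertex i Left j, side_vertex i Left (Suc j)} = dart_edge (dart i (Suc j))"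
  by (simp add: side_vertex_def dart_edge_dart_Suc)

lemma right_edge_eq_dart_edge:
  assumes "i < n" "j < 5"
  shows "{side_vertex i Right j, side_vertex i Right (Suc j)} = dart_edge (dart i (5 - j))"
  using dart_edge_dart_Suc[OF assms(1), of "4 - j"] assms(2)
  by (simp add: side_vertex_def insert_commute flip: Suc_diff_Suc numeral_eq_Suc)

lemma side_vertex_inject:
  assumes "i < n" "j < side_length (Ms ! i) \<sigma>" "i' < n" "j' < side_length (Ms ! i') \<sigma>'"
    and "side_vertex i \<sigma> j = side_vertex i' \<sigma>' j'"
  shows "i = i' \<and> \<sigma> = \<sigma>' \<and> j = j'"
proof -
  have side_corner: "side_corner \<sigma> j < 6"
    "side_corner \<sigma> j \<notin> {attachment_size m, Suc (attachment_size m)}"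
    if "j < side_length m \<sigma>" for j \<sigma> m
    using that by (cases m; cases \<sigma>; auto)+
  have "i = i' \<and> side_corner \<sigma> j = side_corner \<sigma>' j'"
    using assms(5) unfolding side_vertex_def
    by (intro corner_inject) (use assms side_corner in auto)
  then show ?thesis
    using assms(2,4) by (cases "Ms ! i"; cases \<sigma>; cases \<sigma>') auto
qed

lemma dart_edge_cases:
  assumes "i < n" "j < 6"
  shows "(\<exists>i'<n. dart_edge (dart i j) = {side_vertex i' Left 0, side_vertex i' Right 0}) \<or>
    (\<exists>\<sigma>. \<exists>l<side_length (Ms ! i) \<sigma>.
      dart_edge (dart i j) = {side_vertex i \<sigma> l, side_vertex i \<sigma> (Suc l)})"
proof -
  let ?k = "left_length i"
  consider (first_rung) "j = 0" | (left_side) "0 < j" "j \<le> ?k" | (last_rung) "j = Suc ?k"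
    | (right_side) "Suc ?k < j"
    by linarith
  then show ?thesis
  proof cases
    case first_rung
    then show ?thesis using assms(1) rung_eq_dart_edge by metis
  next
    case left_side
    then have "j - 1 < side_length (Ms ! i) Left" "Suc (j - 1) = j" by auto
    then show ?thesis using left_edge_eq_dart_edge[OF assms(1), of "j - 1"] by metis
  next
    case last_rung
    then have "dart_edge (dart i j) = dart_edge (dart (Suc i mod n) 0)"
      using last_dart_edge[OF assms(1)] dart_edge_first_dart[OF Suc_mod_less] by simp
    then show ?thesis using Suc_mod_less rung_eq_dart_edge by metis
  next
    case right_side
    then have "5 - j < side_length (Ms ! i) Right" "5 - (5 - j) = j" "5 - j < 5"
      using assms(2) by auto
    then show ?thesis using right_edge_eq_dart_edge[OF assms(1), of "5 - j"] by metis
  qed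
qed

lemma graph_edges_eq_rungs_sides:
  "graph_edges G = {{side_vertex i Left 0, side_vertex i Right 0} | i. i < n} \<union>
    {{side_vertex i \<sigma> j, side_vertex i \<sigma> (Suc j)} | i \<sigma> j. i < n \<and> j < side_length (Ms ! i) \<sigma>}"
    (is "_ = ?R")
proof
  have dart_edge: "dart_edge (dart i j) \<in> graph_edges G" if "i < n" for i j
    using that dart_in_hexagon by (auto simp: graph_edges_eq_UN face_edges_def)
  have side: "{side_vertex i \<sigma> j, side_vertex i \<sigma> (Suc j)} \<in> graph_edges G"
    if "i < n" "j < side_length (Ms ! i) \<sigma>" for i \<sigma> j
    using that dart_edge
    by (cases \<sigma>) (simp_all add: left_edge_eq_dart_edge right_edge_eq_dart_edge)
  then show "?R \<subseteq> graph_edges G"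
    using rung_eq_dart_edge dart_edge by auto
  show "graph_edges G \<subseteq> ?R"
    using dart_edge_cases by (fastforce simp: graph_edges_eq_UN face_edges_hexagon)
qed

sublocale ladder: cyclic_ladder G n "\<lambda>i. side_length (Ms ! i)" side_vertex
proof
  show "3 \<le> n" by (rule three_le)
next
  fix i \<sigma> assume "i < n"
  show "0 < side_length (Ms ! i) \<sigma>"
    by (cases \<sigma>; cases "Ms ! i") simp_all
  have "5 - (4 - left_length i) = Suc (left_length i)"
    by (cases "Ms ! i") simp_all
  then show "side_vertex i \<sigma> (side_length (Ms ! i) \<sigma>) = side_vertex (Suc i mod n) \<sigma> 0"
    using corner_shared[OF \<open>i < n\<close>] by (cases \<sigma>) (simp_all add: side_vertex_def)
qed (rule side_vertex_inject graph_edges_eq_rungs_sides; assumption?)+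

end

theorem theorem1:
  fixes G :: "'a pair_pre_digraph" and rot :: "'a \<times> 'a \<Rightarrow> 'a \<times> 'a" and n :: nat
    and H :: "nat \<Rightarrow> ('a \<times> 'a) set" and e :: "nat \<Rightarrow> 'a set" and Ms :: "attachment list"
  assumes "hexagonal_ring G rot n H e"
    and "has_ring_type rot n H e Ms"
  shows "int (num_maximal_matchings G) = mat_trace (foldr (*) (map attachment_mat Ms) (1\<^sub>m 9))"
proof -
  interpret typed_hexagonal_ring G rot n H e Ms
    using assms by unfold_locales
  have "num_maximal_matchings G = card (closed_walks (Collect valid_state) hexagon_step Ms)"
    unfolding num_maximal_matchings_def
    using ladder.bij_betw_maximal_matchings_closed_walks[OF length_Ms refl]
    by (rule bij_betw_same_card)
  moreover have "Ms \<noteq> []"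
    using three_le length_Ms by auto
  ultimately show ?thesis
    by (simp add: mat_trace_foldr_mult_attachment_mat)
qed

end
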